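(* Let $p$ be an odd prime. For any integers $i, n, s$ with $0\le s<n$ and $i\ge 1$, $$\mathrm{St}^{\Delta_i}Q_{n,s}=(-1)^n\,[0,1,\ldots,\hat s,\ldots,n-1,i]\,L_n^{p-2}.$$
   Context: $P_n=E(x_1,\ldots,x_n)\otimes\mathbb F_p[y_1,\ldots,y_n]$ (exterior tensor polynomial algebra), graded by $\dim x_j=1$, $\dim y_j=2$, with the usual action of the mod $p$ Steenrod algebra $\mathcal A(p)$. For $i\ge1$, $\mathrm{St}^{\Delta_i}\in\mathcal A(p)$ is the primitive Steenrod–Milnor operation dual to $\xi_i$ with respect to the Milnor monomial basis of $\mathcal A(p)^*$. By the Cartan formula its action on $P_n$ is the $\mathbb F_p$-linear derivation determined by $\mathrm{St}^{\Delta_i}(x_j)=0$, $\mathrm{St}^{\Delta_i}(y_j)=y_j^{p^i}$. For nonnegative integers $e_1,\ldots,e_m$, $[e_1,\ldots,e_m]=\det\big(y_a^{p^{e_b}}\big)_{1\le a,b\le m}\in\mathbb F_p[y_1,\ldots,y_m]$. A hat means the entry is omitted. Put $L_n=[0,1,\ldots,n-1]$, $L_{n,s}=[0,1,\ldots,\hat s,\ldots,n]$ for $0\le s\le n$. The Dickson invariants are $Q_{n,s}=L_{n,s}/L_n$ (each is a polynomial). In $[0,1,\ldots,\hat s,\ldots,n-1,i]$ only the entry $s$ of the list $0,1,\ldots,n-1$ is omitted, and then $i$ is appended at the end. *)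

theory Defs
  imports
    "HOL-Library.Poly_Mapping"
    "HOL-Library.FuncSet"
    "Berlekamp_Zassenhaus.Finite_Field"
    "Jordan_Normal_Form.Determinant"
begin

section \<open>The polynomial algebra\<close>

text \<open>
  The prime is \<open>p = CARD('p)\<close> with \<open>'p :: prime_card\<close>, and \<open>'p mod_ring\<close> is the field with
  \<open>p\<close> elements. Polynomials in \<open>y\<^sub>1, y\<^sub>2, \<dots>\<close> are finitely supported functions on the monomials
  \<open>nat \<Rightarrow>\<^sub>0 nat\<close>; the index 0 is not used as a variable.
\<close>

type_synonym 'p pol = "(nat \<Rightarrow>\<^sub>0 nat) \<Rightarrow>\<^sub>0 'p mod_ring"

definition Y :: "nat \<Rightarrow> 'p::prime_card pol" where
  "Y j = Poly_Mapping.single (Poly_Mapping.single j 1) 1"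

definition Const :: "'p::prime_card mod_ring \<Rightarrow> 'p pol" where
  "Const c = Poly_Mapping.single 0 c"

definition pols :: "nat \<Rightarrow> 'p::prime_card pol set" where
  "pols n = {f. \<forall>m \<in> Poly_Mapping.keys f. Poly_Mapping.keys m \<subseteq> {1..n}}"

definition bracket :: "nat list \<Rightarrow> 'p::prime_card pol" where
  "bracket es = det (mat (length es) (length es) (\<lambda>(a, b). Y (Suc a) ^ (CARD('p) ^ (es ! b))))"

definition L :: "nat \<Rightarrow> 'p::prime_card pol" where
  "L n = bracket [0..<n]"

definition L_omit :: "nat \<Rightarrow> nat \<Rightarrow> 'p::prime_card pol" where
  "L_omit n s = bracket ([0..<s] @ [Suc s..<Suc n])"

text \<open>The exact quotient \<open>L_omit n s / L n\<close> in the polynomial ring, which is an integral domain.\<close>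

definition dickson :: "nat \<Rightarrow> nat \<Rightarrow> 'p::prime_card pol" where
  "dickson n s = (THE q. q \<in> pols n \<and> q * L n = L_omit n s)"


section \<open>The algebra \<open>E(x\<^sub>1, \<dots>, x\<^sub>n) \<otimes> F\<^sub>p[y\<^sub>1, \<dots>, y\<^sub>n]\<close>\<close>

text \<open>
  An element is written uniquely as the sum over \<open>S \<subseteq> {1..n}\<close> of \<open>x\<^sub>S F(S)\<close>, where \<open>F(S)\<close> is a
  polynomial and \<open>x\<^sub>S\<close> is the product of the \<open>x\<^sub>j\<close>, \<open>j \<in> S\<close>, in increasing order. It is
  represented by the function \<open>F\<close>. For disjoint \<open>S\<close> and \<open>T\<close>, \<open>x\<^sub>S x\<^sub>T = \<plusminus> x\<^bsub>S \<union> T\<^esub>\<close>, the sign being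
  \<open>shuffle_sign S T\<close>; otherwise the product is 0.
\<close>

type_synonym 'p epol = "nat set \<Rightarrow> 'p pol"

definition P :: "nat \<Rightarrow> 'p::prime_card epol set" where
  "P n = {F. (\<forall>S. F S \<in> pols n) \<and> (\<forall>S. \<not> S \<subseteq> {1..n} \<longrightarrow> F S = 0)}"

definition shuffle_sign :: "nat set \<Rightarrow> nat set \<Rightarrow> 'p::prime_card pol" where
  "shuffle_sign S T = (-1) ^ card {(s, t). s \<in> S \<and> t \<in> T \<and> t < s}"

definition eadd :: "'p::prime_card epol \<Rightarrow> 'p epol \<Rightarrow> 'p epol" where
  "eadd F G = (\<lambda>U. F U + G U)"

definition escale :: "'p::prime_card mod_ring \<Rightarrow> 'p epol \<Rightarrow> 'p epol" where
  "escale c F = (\<lambda>U. Const c * F U)"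

definition emult :: "'p::prime_card epol \<Rightarrow> 'p epol \<Rightarrow> 'p epol" where
  "emult F G = (\<lambda>U. \<Sum>S\<in>Pow U. shuffle_sign S (U - S) * F S * G (U - S))"

definition X :: "nat \<Rightarrow> 'p::prime_card epol" where
  "X j = (\<lambda>U. if U = {j} then 1 else 0)"

definition of_pol :: "'p::prime_card pol \<Rightarrow> 'p epol" where
  "of_pol f = (\<lambda>U. if U = {} then f else 0)"


section \<open>The primitive Steenrod--Milnor operations\<close>

text \<open>
  The operation dual to \<open>\<xi>\<^sub>i\<close> has the even degree \<open>2 (p\<^sup>i - 1)\<close>, so the Leibniz rule carries no
  signs. Functions on the carrier \<open>P n\<close> are taken to be \<open>undefined\<close> outside of it, so that the
  operation is a unique HOL function (lemma \<open>ex1_St_Delta\<close> below).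
\<close>

definition is_St_Delta :: "nat \<Rightarrow> nat \<Rightarrow> ('p::prime_card epol \<Rightarrow> 'p epol) \<Rightarrow> bool" where
  "is_St_Delta i n D \<longleftrightarrow>
     D \<in> P n \<rightarrow>\<^sub>E P n \<and>
     (\<forall>F\<in>P n. \<forall>G\<in>P n. D (eadd F G) = eadd (D F) (D G)) \<and>
     (\<forall>c. \<forall>F\<in>P n. D (escale c F) = escale c (D F)) \<and>
     (\<forall>F\<in>P n. \<forall>G\<in>P n. D (emult F G) = eadd (emult (D F) G) (emult F (D G))) \<and>
     (\<forall>j\<in>{1..n}. D (X j) = of_pol 0) \<and>
     (\<forall>j\<in>{1..n}. D (of_pol (Y j)) = of_pol (Y j ^ (CARD('p) ^ i)))"

definition St_Delta :: "nat \<Rightarrow> nat \<Rightarrow> 'p::prime_card epol \<Rightarrow> 'p epol" where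
  "St_Delta i n = (THE D. is_St_Delta i n D)"


subsection \<open>Existence and uniqueness\<close>

lemma pol_induct [case_names zero single add]:
  fixes f :: "'p::prime_card pol"
  assumes "Q 0" "\<And>m c. m \<in> Poly_Mapping.keys f \<Longrightarrow> Q (Poly_Mapping.single m c)"
    and "\<And>g h. Q g \<Longrightarrow> Q h \<Longrightarrow> Q (g + h)"
  shows "Q f"
proof -
  have sum: "Q (\<Sum>m\<in>A. Poly_Mapping.single m (Poly_Mapping.lookup f m))"
    if "finite A" "A \<subseteq> Poly_Mapping.keys f" for A
    using that by (induction A rule: finite_induct) (use assms in auto)
  have "f = (\<Sum>m\<in>Poly_Mapping.keys f. Poly_Mapping.single m (Poly_Mapping.lookup f m))"
    by (rule poly_mapping_eqI)
      (auto simp: lookup_sum lookup_single when_def sum.delta in_keys_iff)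
  then show ?thesis using sum[of "Poly_Mapping.keys f"] by simp
qed

definition pderivation :: "nat \<Rightarrow> nat \<Rightarrow> 'p::prime_card pol \<Rightarrow> 'p pol" where
  "pderivation q j f = (\<Sum>m\<in>Poly_Mapping.keys f. Poly_Mapping.single
     (m + Poly_Mapping.single j q) (Poly_Mapping.lookup f m * of_nat (Poly_Mapping.lookup m j)))"

lemma pderivation_zero: "pderivation q j 0 = 0"
  by (simp add: pderivation_def)

lemma pderivation_single: "pderivation q j (Poly_Mapping.single m c) =
    Poly_Mapping.single (m + Poly_Mapping.single j q) (c * of_nat (Poly_Mapping.lookup m j))"
  by (simp add: pderivation_def)

lemma pderivation_add: "pderivation q j (f + g) = pderivation q j f + pderivation q j g"
  unfolding pderivation_def
  by (rule setsum_keys_plus_distrib) (simp_all add: distrib_right single_add)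

lemma pderivation_mult:
  "pderivation q j (f * g) = pderivation q j f * g + f * pderivation q j g"
proof (induction f rule: pol_induct)
  case (single m c)
  show ?case
  proof (induction g rule: pol_induct)
    case (single k b)
    let ?e = "Poly_Mapping.single j q"
    have "m + k + ?e = m + ?e + k" "m + k + ?e = m + (k + ?e)" by (simp_all add: ac_simps)
    moreover have "c * b * of_nat (Poly_Mapping.lookup (m + k) j) =
        c * of_nat (Poly_Mapping.lookup m j) * b + c * (b * of_nat (Poly_Mapping.lookup k j))"
      by (simp add: lookup_add algebra_simps)
    ultimately show ?case by (simp only: pderivation_single mult_single single_add)
  qed (simp_all add: pderivation_zero pderivation_add distrib_left)
qed (simp_all add: pderivation_zero pderivation_add distrib_right)

lemma pols_zero: "0 \<in> pols n" and pols_one: "1 \<in> pols n"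
  by (auto simp: pols_def)

lemma pols_add: "f \<in> pols n \<Longrightarrow> g \<in> pols n \<Longrightarrow> f + g \<in> pols n"
  using keys_add[of f g] unfolding pols_def by blast

lemma pols_mult: "f \<in> pols n \<Longrightarrow> g \<in> pols n \<Longrightarrow> f * g \<in> pols n"
proof -
  assume fg: "f \<in> pols n" "g \<in> pols n"
  have "Poly_Mapping.keys m \<subseteq> {1..n}" if m: "m \<in> Poly_Mapping.keys (f * g)" for m
  proof -
    from subsetD[OF keys_mult m]
    obtain a b where "m = a + b" "a \<in> Poly_Mapping.keys f" "b \<in> Poly_Mapping.keys g" by blast
    then show ?thesis using fg keys_add[of a b] unfolding pols_def by blast
  qed
  then show ?thesis unfolding pols_def by blast
qed

lemma pols_uminus: "f \<in> pols n \<Longrightarrow> - f \<in> pols n"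
  by (auto simp: pols_def in_keys_iff)

lemma pols_sum: "(\<And>a. a \<in> A \<Longrightarrow> f a \<in> pols n) \<Longrightarrow> sum f A \<in> pols n"
  by (induction A rule: infinite_finite_induct) (auto intro: pols_zero pols_add)

lemma pols_power: "f \<in> pols n \<Longrightarrow> f ^ k \<in> pols n"
  by (induction k) (auto intro: pols_one pols_mult)

lemma pols_Const: "Const c \<in> pols n"
  by (simp add: Const_def pols_def)

lemma pols_single: "Poly_Mapping.keys m \<subseteq> {1..n} \<Longrightarrow> Poly_Mapping.single m c \<in> pols n"
  by (simp add: pols_def)

lemma pols_Y: "j \<in> {1..n} \<Longrightarrow> Y j \<in> pols n"
  by (simp add: Y_def pols_def)

lemma pols_sign: "shuffle_sign S T \<in> pols n"
  unfolding shuffle_sign_def by (intro pols_power pols_uminus pols_one)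

lemma pols_pderivation: "j \<in> {1..n} \<Longrightarrow> f \<in> pols n \<Longrightarrow> pderivation q j f \<in> pols n"
  unfolding pderivation_def
  by (rule pols_sum, rule pols_single, rule order_trans[OF keys_add]) (auto simp: pols_def)

lemma P_of_pol: "f \<in> pols n \<Longrightarrow> of_pol f \<in> P n"
  by (simp add: P_def of_pol_def pols_zero)

lemma P_X: "j \<in> {1..n} \<Longrightarrow> X j \<in> P n"
  by (simp add: P_def X_def pols_zero pols_one)

lemma P_eadd: "F \<in> P n \<Longrightarrow> G \<in> P n \<Longrightarrow> eadd F G \<in> P n"
  by (simp add: P_def eadd_def pols_add)

lemma P_escale: "F \<in> P n \<Longrightarrow> escale c F \<in> P n"
  by (simp add: P_def escale_def pols_mult pols_Const)

lemma P_emult: "F \<in> P n \<Longrightarrow> G \<in> P n \<Longrightarrow> emult F G \<in> P n"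
proof -
  assume F: "F \<in> P n" and G: "G \<in> P n"
  have "emult F G U = 0" if "\<not> U \<subseteq> {1..n}" for U
    unfolding emult_def
  proof (rule sum.neutral, rule ballI)
    fix S assume "S \<in> Pow U"
    then have "\<not> S \<subseteq> {1..n} \<or> \<not> U - S \<subseteq> {1..n}" using that by blast
    then have "F S = 0 \<or> G (U - S) = 0" using F G unfolding P_def by blast
    then show "shuffle_sign S (U - S) * F S * G (U - S) = 0" by auto
  qed
  then show ?thesis using F G
    by (auto simp: P_def emult_def intro!: pols_sum pols_mult pols_sign)
qed

lemma ex_St_Delta:
  assumes "1 \<le> i"
  shows "\<exists>D :: 'p::prime_card epol \<Rightarrow> 'p epol. is_St_Delta i n D"
proof -
  define q where "q = CARD('p) ^ i - 1"
  have "0 < CARD('p) ^ i" using prime_card[where 'a='p] prime_gt_0_nat by auto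
  then have q: "CARD('p) ^ i = Suc q" by (simp add: q_def)
  define d :: "'p pol \<Rightarrow> 'p pol" where "d f = (\<Sum>j\<in>{1..n}. pderivation q j f)" for f
  have d0: "d 0 = 0" by (simp add: d_def pderivation_zero)
  have d_add: "d (f + g) = d f + d g" for f g
    by (simp add: d_def pderivation_add sum.distrib)
  have d_mult: "d (f * g) = d f * g + f * d g" for f g
    by (simp add: d_def pderivation_mult sum.distrib sum_distrib_left sum_distrib_right)
  have d_Const: "d (Const c) = 0" for c
    by (simp add: d_def Const_def pderivation_single)
  have d_one: "d 1 = 0"
    using d_Const[of 1] by (simp add: Const_def)
  have d_scale: "d (Const c * f) = Const c * d f" for c f
    by (simp add: d_mult d_Const)
  have d_sign: "d (shuffle_sign S T) = 0" for S T
  proof -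
    have "d (- f) = - d f" for f
      using d_add[of f "- f"] by (simp add: d0 eq_neg_iff_add_eq_0 add.commute)
    then show ?thesis
      unfolding shuffle_sign_def
      by (cases "even (card {(s, t). s \<in> S \<and> t \<in> T \<and> t < s})") (simp_all add: d_one)
  qed
  have d_sum: "d (sum f A) = (\<Sum>a\<in>A. d (f a))" for f :: "nat set \<Rightarrow> 'p pol" and A
    by (induction A rule: infinite_finite_induct) (simp_all add: d0 d_add)
  have pw: "Y j ^ k = Poly_Mapping.single (Poly_Mapping.single j k) (1 :: 'p mod_ring)" for j k
    by (induction k) (simp_all add: Y_def mult_single single_add [symmetric])
  have d_Y: "d (Y j) = Y j ^ (CARD('p) ^ i)" if "j \<in> {1..n}" for j
  proof -
    have "d (Y j) = (\<Sum>k\<in>{1..n}. if k = j then Y j ^ Suc q else 0)"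
      unfolding d_def pw
      by (rule sum.cong) (auto simp: Y_def pderivation_single single_add [symmetric] lookup_single)
    then show ?thesis using that by (simp add: q)
  qed
  define D :: "'p epol \<Rightarrow> 'p epol" where "D = restrict (\<lambda>F U. d (F U)) (P n)"
  have D: "D F = (\<lambda>U. d (F U))" if "F \<in> P n" for F using that by (simp add: D_def)
  have "d f \<in> pols n" if "f \<in> pols n" for f
    using that unfolding d_def by (intro pols_sum pols_pderivation)
  then have "(\<lambda>U. d (F U)) \<in> P n" if "F \<in> P n" for F
    using that unfolding P_def by (simp add: d0)
  then have "D \<in> P n \<rightarrow>\<^sub>E P n"
    unfolding D_def by simp
  moreover have "D (emult F G) = eadd (emult (D F) G) (emult F (D G))"
    if "F \<in> P n" "G \<in> P n" for F G
    using that by (simp add: D P_emult)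
      (simp add: emult_def eadd_def d_sum d_mult d_sign sum.distrib [symmetric] algebra_simps)
  moreover have "D (eadd F G) = eadd (D F) (D G)" if "F \<in> P n" "G \<in> P n" for F G
    using that by (simp add: D P_eadd) (simp add: eadd_def d_add)
  moreover have "D (escale c F) = escale c (D F)" if "F \<in> P n" for F c
    using that by (simp add: D P_escale) (simp add: escale_def d_scale)
  moreover have "D (X j) = of_pol 0" if "j \<in> {1..n}" for j
    using that by (simp add: D P_X) (auto simp: X_def of_pol_def d_one d0)
  moreover have "D (of_pol (Y j)) = of_pol (Y j ^ (CARD('p) ^ i))" if "j \<in> {1..n}" for j
    using that by (simp add: D P_of_pol pols_Y) (auto simp: of_pol_def d_Y d0)
  ultimately show ?thesis unfolding is_St_Delta_def by blast
qed

definition ext_monom :: "nat set \<Rightarrow> 'p::prime_card epol" where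
  "ext_monom S = (\<lambda>U. if U = S then 1 else 0)"

lemma shuffle_sign_empty: "shuffle_sign {} T = 1" "shuffle_sign S {} = 1"
  by (simp_all add: shuffle_sign_def)

lemma shuffle_sign_less:
  assumes "\<forall>t\<in>T. j < t"
  shows "shuffle_sign {j} T = 1"
proof -
  have "{(s, t). s \<in> {j} \<and> t \<in> T \<and> t < s} = {}" using assms by force
  then show ?thesis unfolding shuffle_sign_def by (simp only: card.empty power_0)
qed

lemma emult_delta:
  assumes "finite S" "finite T" "S \<inter> T = {}" "shuffle_sign S T = (1 :: 'p::prime_card pol)"
  shows "emult (\<lambda>U. if U = S then f else 0) (\<lambda>U. if U = T then g else 0) =
    (\<lambda>U. if U = S \<union> T then f * g else (0 :: 'p pol))"
proof
  fix U
  let ?h = "\<lambda>A. if A = S \<and> U = S \<union> T then f * g else 0"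
  have "emult (\<lambda>U. if U = S then f else 0) (\<lambda>U. if U = T then g else 0) U = (\<Sum>A\<in>Pow U. ?h A)"
    unfolding emult_def by (rule sum.cong) (use assms in auto)
  also have "\<dots> = (if U = S \<union> T then f * g else 0)"
    using assms by (auto intro!: sum.neutral simp: sum.delta)
  finally show "emult (\<lambda>U. if U = S then f else 0) (\<lambda>U. if U = T then g else 0) U =
    (if U = S \<union> T then f * g else 0)" .
qed

lemma emult_of_pol: "emult (of_pol f) (of_pol g) = of_pol (f * g)"
  unfolding of_pol_def by (subst emult_delta) (auto simp: shuffle_sign_empty)

lemma emult_of_pol_ext_monom:
  "finite S \<Longrightarrow> emult (of_pol f) (ext_monom S) = (\<lambda>U. if U = S then f else 0)"
  unfolding of_pol_def ext_monom_def by (subst emult_delta) (auto simp: shuffle_sign_empty)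

lemma emult_X_ext_monom:
  "finite S \<Longrightarrow> \<forall>t\<in>S. j < t \<Longrightarrow> emult (X j) (ext_monom S) = ext_monom (insert j S)"
  unfolding X_def ext_monom_def by (subst emult_delta) (auto simp: shuffle_sign_less)

lemma P_ext_monom: "S \<subseteq> {1..n} \<Longrightarrow> ext_monom S \<in> P n"
  by (simp add: P_def ext_monom_def pols_zero pols_one)

lemma St_Delta_unique:
  assumes "is_St_Delta i n D" "is_St_Delta i n E"
  shows "D = (E :: 'p::prime_card epol \<Rightarrow> 'p epol)"
proof -
  define A where "A = {F \<in> P n. D F = E F}"
  have A_add: "eadd F G \<in> A" if "F \<in> A" "G \<in> A" for F G
    using that assms by (simp add: A_def is_St_Delta_def P_eadd)
  have A_scale: "escale c F \<in> A" if "F \<in> A" for F c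
    using that assms by (simp add: A_def is_St_Delta_def P_escale)
  have A_mult: "emult F G \<in> A" if "F \<in> A" "G \<in> A" for F G
    using that assms by (simp add: A_def is_St_Delta_def P_emult)
  have A_X: "X j \<in> A" if "j \<in> {1..n}" for j
    using that assms by (simp add: A_def is_St_Delta_def P_X)
  have A_Y: "of_pol (Y j) \<in> A" if "j \<in> {1..n}" for j
    using that assms by (simp add: A_def is_St_Delta_def P_of_pol pols_Y)
  have one: "of_pol 1 \<in> A"
  proof -
    have "B (of_pol 1) = of_pol 0" if B: "is_St_Delta i n B" for B :: "'p epol \<Rightarrow> 'p epol"
    proof -
      let ?u = "of_pol 1 :: 'p epol"
      have u: "?u \<in> P n" by (rule P_of_pol[OF pols_one])
      have left: "emult ?u F = F" and right: "emult F ?u = F" if "F \<in> P n" for F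
      proof -
        show "emult ?u F = F"
        proof
          fix U show "emult ?u F U = F U"
          proof (cases "finite U")
            case True
            have "emult ?u F U = (\<Sum>S\<in>Pow U. if S = {} then F U else 0)"
              unfolding emult_def by (rule sum.cong) (auto simp: of_pol_def shuffle_sign_empty)
            then show ?thesis using True by (simp add: sum.delta)
          next
            case False
            then have "\<not> U \<subseteq> {1..n}" using finite_subset by blast
            then show ?thesis using that False by (simp add: P_def emult_def)
          qed
        qed
        show "emult F ?u = F"
        proof
          fix U show "emult F ?u U = F U"
          proof (cases "finite U")
            case True
            have "emult F ?u U = (\<Sum>S\<in>Pow U. if S = U then F U else 0)"
              unfolding emult_def by (rule sum.cong) (auto simp: of_pol_def shuffle_sign_empty Diff_cancel)
            then show ?thesis using True by (simp add: sum.delta)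
          next
            case False
            then have "\<not> U \<subseteq> {1..n}" using finite_subset by blast
            then show ?thesis using that False by (simp add: P_def emult_def)
          qed
        qed
      qed
      have Bu: "B ?u \<in> P n" using B u unfolding is_St_Delta_def by blast
      have "B ?u = eadd (emult (B ?u) ?u) (emult ?u (B ?u))"
        using B u left[OF u] unfolding is_St_Delta_def by metis
      then have "B ?u = eadd (B ?u) (B ?u)" using left[OF Bu] right[OF Bu] by simp
      then have "B ?u U = B ?u U + B ?u U" for U unfolding eadd_def by meson
      then have "B ?u U = 0" for U by (metis add_cancel_right_right)
      then show ?thesis unfolding of_pol_def by (intro ext) simp
    qed
    then show ?thesis using assms P_of_pol[OF pols_one] by (simp add: A_def)
  qed
  have A_monom: "of_pol (Poly_Mapping.single m c) \<in> A" if "Poly_Mapping.keys m \<subseteq> {1..n}" for m c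
  proof -
    have pow: "of_pol (Y j ^ k) \<in> A" if "j \<in> {1..n}" for j k
    proof (induction k)
      case (Suc k)
      then show ?case using A_mult[OF A_Y[OF that] Suc] by (simp add: emult_of_pol)
    qed (simp add: one)
    have pw: "Y j ^ k = Poly_Mapping.single (Poly_Mapping.single j k) (1 :: 'p mod_ring)" for j k
      by (induction k) (simp_all add: Y_def mult_single single_add [symmetric])
    have "of_pol (Poly_Mapping.single m 1) \<in> A" using that
    proof (induction m rule: update_induct)
      case const
      then show ?case using one by simp
    next
      case (update m j k)
      have eq: "Poly_Mapping.update j k m = Poly_Mapping.single j k + m"
        using update(1)
        by (intro poly_mapping_eqI) (auto simp: lookup_update lookup_add lookup_single in_keys_iff)
      have "j \<in> {1..n}" "Poly_Mapping.keys m \<subseteq> {1..n}"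
        using update by (auto simp: keys_update)
      then have "emult (of_pol (Y j ^ k)) (of_pol (Poly_Mapping.single m 1)) \<in> A"
        using update pow A_mult by blast
      then show ?case by (simp add: emult_of_pol pw mult_single eq)
    qed
    from A_scale[OF this, of c] show ?thesis
      by (simp add: escale_def of_pol_def Const_def mult_single if_distrib cong: if_cong)
  qed
  have A_pol: "of_pol f \<in> A" if "f \<in> pols n" for f
  proof (induction f rule: pol_induct)
    case zero
    then show ?case using A_monom[of 0 0] by simp
  next
    case (single m c)
    then show ?case using A_monom that by (auto simp: pols_def)
  next
    case (add g h)
    have "eadd (of_pol g) (of_pol h) = of_pol (g + h)" by (auto simp: eadd_def of_pol_def)
    then show ?case using A_add[OF add] by simp
  qed
  have A_ext: "ext_monom S \<in> A" if "finite S" "S \<subseteq> {1..n}" for S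
    using that
  proof (induction S rule: finite_linorder_min_induct)
    case empty
    then show ?case using one by (simp add: ext_monom_def of_pol_def)
  next
    case (insert j S)
    then have "emult (X j) (ext_monom S) \<in> A" by (intro A_mult A_X) simp_all
    then show ?case using insert.hyps by (simp add: emult_X_ext_monom)
  qed
  have sum: "(\<lambda>U. if U \<in> B then F U else 0) \<in> A" if "finite B" "B \<subseteq> Pow {1..n}" "F \<in> P n" for B F
    using that
  proof (induction B rule: finite_induct)
    case empty
    have "(\<lambda>U. if U \<in> {} then F U else 0) = of_pol 0" by (auto simp: of_pol_def)
    then show ?case using A_pol[OF pols_zero] by simp
  next
    case (insert S B)
    have S: "finite S" "S \<subseteq> {1..n}" using insert.prems finite_subset by auto
    then have "emult (of_pol (F S)) (ext_monom S) \<in> A"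
      using insert.prems by (intro A_mult A_pol A_ext) (auto simp: P_def)
    then have "eadd (\<lambda>U. if U = S then F S else 0) (\<lambda>U. if U \<in> B then F U else 0) \<in> A"
      using insert S by (intro A_add) (auto simp: emult_of_pol_ext_monom)
    moreover have "eadd (\<lambda>U. if U = S then F S else 0) (\<lambda>U. if U \<in> B then F U else 0) =
        (\<lambda>U. if U \<in> insert S B then F U else 0)"
      using insert.hyps by (auto simp: eadd_def)
    ultimately show ?case by simp
  qed
  have "F \<in> A" if "F \<in> P n" for F
  proof -
    have "(\<lambda>U. if U \<in> Pow {1..n} then F U else 0) = F" using that by (auto simp: P_def)
    then show ?thesis using sum[of "Pow {1..n}" F] that by simp
  qed
  then show ?thesis
    using assms unfolding is_St_Delta_def
    by (intro PiE_ext[of D "P n" "\<lambda>_. P n" E]) (auto simp: A_def)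
qed

lemma ex1_St_Delta:
  "1 \<le> i \<Longrightarrow> \<exists>!D :: 'p::prime_card epol \<Rightarrow> 'p epol. is_St_Delta i n D"
  using ex_St_Delta St_Delta_unique by blast

end

theory Submission
  imports Defs
begin

text \<open>
  Let \<open>f\<^sub>n(X)\<close> be the product of \<open>X - v\<close> over all linear combinations \<open>v\<close> of
  \<open>y\<^sub>1, \<dots>, y\<^sub>n\<close> with coefficients in the field of \<open>p\<close> elements. It is additive: \<open>f\<^sub>n(X) = \<Sum>s\<le>n. c\<^sub>s X\<^bsup>p^s\<^esup>\<close> with \<open>c\<^sub>n = 1\<close>. Evaluation at
  \<open>y\<^sub>1, \<dots>, y\<^sub>n\<close> gives \<open>n\<close> linear equations

    \<open>(\<Sum>s<n. c\<^sub>s y\<^sub>a\<^bsup>p^s\<^esup>) = - y\<^sub>a\<^bsup>p^n\<^esup>\<close>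

  for \<open>c\<^sub>0, \<dots>, c\<^bsub>n-1\<^esub>\<close>, whose matrix has determinant \<open>L\<^sub>n\<close>. Cramer's rule (\<open>cramer_bracket\<close>)
  turns them into \<open>c\<^sub>s L\<^sub>n = (-1)\<^bsup>n-s\<^esup> L\<^bsub>n,s\<^esub>\<close>, so that \<open>c\<^sub>s\<close> is the Dickson invariant
  \<open>Q\<^bsub>n,s\<^esub>\<close> up to the sign \<open>(-1)\<^bsup>n-s\<^esup>\<close> (\<open>dickson_eq_root_coeff\<close>).

  Apply to the same equations a derivation \<open>\<delta>\<close> with \<open>\<delta>(y\<^sub>a) = y\<^sub>a\<^bsup>p^i\<^esup>\<close>. In characteristic
  \<open>p\<close> it kills \<open>p\<close>-th powers, so among the powers \<open>y\<^sub>a\<^bsup>p^s\<^esup>\<close> only the one with \<open>s = 0\<close> is moved: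

    \<open>(\<Sum>s<n. \<delta>(c\<^sub>s) y\<^sub>a\<^bsup>p^s\<^esup>) = - c\<^sub>0 y\<^sub>a\<^bsup>p^i\<^esup>\<close>.

  This is again a system with determinant \<open>L\<^sub>n\<close>, and Cramer's rule expresses \<open>\<delta>(c\<^sub>s) L\<^sub>n\<close> by
  \<open>c\<^sub>0\<close> times the bracket in which the column \<open>s\<close> is replaced by the exponent \<open>i\<close>. Finally
  \<open>c\<^sub>0 = (-1)\<^sup>n L\<^sub>n\<^bsup>p-1\<^esup>\<close> (\<open>root_coeff_0\<close>), and one factor \<open>L\<^sub>n \<noteq> 0\<close> cancels.

  The recursion \<open>f\<^bsub>n+1\<^esub>(X) = f\<^sub>n(X)\<^sup>p - f\<^sub>n(y\<^bsub>n+1\<^esub>)\<^bsup>p-1\<^esup> f\<^sub>n(X)\<close> serves as the definition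
  of the \<open>c\<^sub>s\<close>. It yields by induction the vanishing at the \<open>y\<^sub>a\<close>, the value of \<open>c\<^sub>0\<close>, and, through
  \<open>L\<^bsub>n+1\<^esub> = f\<^sub>n(y\<^bsub>n+1\<^esub>) L\<^sub>n\<close>, the fact that \<open>L\<^sub>n \<noteq> 0\<close>.
\<close>


section \<open>The coefficient ring\<close>

lemma CHAR_pol: "CHAR('p::prime_card pol) = CARD('p)"
proof (rule CHAR_eqI)
  show "of_nat CARD('p) = (0 :: 'p pol)"
    by (rule poly_mapping_eqI) (simp add: lookup_of_nat)
next
  fix x assume "of_nat x = (0 :: 'p pol)"
  then have "Poly_Mapping.lookup (of_nat x :: 'p pol) 0 = 0" by simp
  then have "of_nat x = (0 :: 'p mod_ring)" by (simp add: lookup_of_nat)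
  then show "CARD('p) dvd x" by (rule of_nat_0_mod_ring_dvd)
qed

lemma pols_mono: "m \<le> n \<Longrightarrow> pols m \<subseteq> pols n"
  by (fastforce simp: pols_def)

lemma pols_diff: "f \<in> pols n \<Longrightarrow> g \<in> pols n \<Longrightarrow> f - g \<in> pols n"
  using pols_add[OF _ pols_uminus, of f n g] by simp

lemma Y_power: "Y j ^ k = Poly_Mapping.single (Poly_Mapping.single j k) (1 :: 'p::prime_card mod_ring)"
  by (induction k) (simp_all add: Y_def mult_single single_add [symmetric])


section \<open>Brackets and Cramer's rule\<close>

lemma bracket_swap:
  "bracket (xs @ a # b # ys) = - (bracket (xs @ b # a # ys) :: 'p::prime_card pol)"
proof -
  define k where "k = length xs"
  define N where "N = Suc (Suc (length xs + length ys))"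
  define M :: "nat list \<Rightarrow> 'p pol mat"
    where "M es = mat N N (\<lambda>(r, t). Y (Suc r) ^ (CARD('p) ^ (es ! t)))" for es
  have "M (xs @ a # b # ys) = swapcols k (Suc k) (M (xs @ b # a # ys))"
    by (rule eq_matI) (auto simp: M_def mat_swapcols_def k_def N_def nth_append nth_Cons split: nat.splits)
  moreover have "det (swapcols k (Suc k) (M (xs @ b # a # ys))) = - det (M (xs @ b # a # ys))"
    by (rule det_swapcols[of _ N]) (auto simp: M_def N_def k_def)
  ultimately have "det (M (xs @ a # b # ys)) = - det (M (xs @ b # a # ys))" by simp
  then show ?thesis by (simp add: bracket_def M_def N_def)
qed

lemma bracket_move_last:
  "bracket (xs @ a # ys) = (-1) ^ length ys * (bracket (xs @ ys @ [a]) :: 'p::prime_card pol)"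
proof (induction ys arbitrary: xs)
  case (Cons b ys)
  show ?case using Cons.IH[of "xs @ [b]"] by (simp add: bracket_swap[of xs a b ys])
qed simp

lemma det_replace_col_smult:
  fixes A :: "'a::comm_ring_1 mat"
  assumes A: "A \<in> carrier_mat n n" and v: "v \<in> carrier_vec n" and s: "s < n"
  shows "det (replace_col A (u \<cdot>\<^sub>v v) s) = u * det (replace_col A v s)"
proof -
  have C: "replace_col A w s \<in> carrier_mat n n" for w
    using A by (simp add: replace_col_def)
  have minor: "mat_delete (replace_col A w s) a s = mat_delete A a s" for w a
    by (rule eq_matI) (use A s in \<open>auto simp: mat_delete_def replace_col_def\<close>)
  have "det (replace_col A w s) = (\<Sum>a<n. w $ a * cofactor A a s)" for w
    using A s
    by (subst laplace_expansion_column[OF C s]) (simp add: cofactor_def minor, simp add: replace_col_def)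
  then show ?thesis using v by (simp add: sum_distrib_left mult.assoc)
qed

text \<open>
  A common multiple \<open>u\<close> of the bracket column with exponent \<open>e\<close> stands on the right-hand side, since
  both the equations for the coefficients of \<open>f\<^sub>n\<close> and those for their derivatives have this form.
  The sign comes from moving the replaced column across the \<open>n - 1 - s\<close> columns on its right.
\<close>

lemma cramer_bracket:
  fixes x :: "nat \<Rightarrow> 'p::prime_card pol"
  assumes sol: "\<And>a. a \<in> {1..n} \<Longrightarrow>
      (\<Sum>t<n. x t * Y a ^ (CARD('p) ^ t)) = u * Y a ^ (CARD('p) ^ e)"
    and s: "s < n"
  shows "x s * L n = (-1) ^ (n - 1 - s) * u * bracket ([0..<s] @ [Suc s..<n] @ [e])"
proof -
  define A :: "'p pol mat" where "A = mat n n (\<lambda>(a, b). Y (Suc a) ^ (CARD('p) ^ b))"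
  define v where "v = vec n (\<lambda>a. Y (Suc a) ^ (CARD('p) ^ e) :: 'p pol)"
  define es where "es = [0..<s] @ e # [Suc s..<n]"
  have A: "A \<in> carrier_mat n n" by (simp add: A_def)
  have L: "det A = L n"
    unfolding L_def bracket_def A_def by (intro arg_cong[of _ _ det] eq_matI) auto
  have es: "length es = n" "\<And>b. b < n \<Longrightarrow> es ! b = (if b = s then e else b)"
    using s by (auto simp: es_def nth_append nth_Cons split: nat.splits)
  have Ax: "A *\<^sub>v vec n x = u \<cdot>\<^sub>v v"
  proof (rule eq_vecI)
    fix a assume "a < dim_vec (u \<cdot>\<^sub>v v)"
    then have a: "a < n" by (simp add: v_def)
    then have "(A *\<^sub>v vec n x) $ a = (\<Sum>t<n. x t * Y (Suc a) ^ (CARD('p) ^ t))"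
      by (auto simp: A_def scalar_prod_def lessThan_atLeast0 mult.commute intro!: sum.cong)
    also have "\<dots> = (u \<cdot>\<^sub>v v) $ a" using a sol[of "Suc a"] by (simp add: v_def)
    finally show "(A *\<^sub>v vec n x) $ a = (u \<cdot>\<^sub>v v) $ a" .
  qed (simp add: A_def v_def)
  have "x s * L n = det (replace_col A (u \<cdot>\<^sub>v v) s)"
    using cramer_lemma_mat[OF A _ s, of "vec n x"] s by (simp add: Ax L)
  also have "\<dots> = u * det (replace_col A v s)"
    by (rule det_replace_col_smult[OF A _ s]) (simp add: v_def)
  also have "det (replace_col A v s) = bracket es"
    unfolding bracket_def
    by (intro arg_cong[of _ _ det] eq_matI) (auto simp: es A_def v_def replace_col_def)
  also have "bracket es = (-1) ^ (n - 1 - s) * bracket ([0..<s] @ [Suc s..<n] @ [e])"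
    using bracket_move_last[of "[0..<s]" e "[Suc s..<n]"] by (simp add: es_def)
  finally show ?thesis by (simp add: mult_ac)
qed

text \<open>
  The hypothesis is a relation that holds in all rows but the last one of the matrix of
  \<open>L (Suc n)\<close>. Replacing the last column by this combination of the columns leaves the determinant
  unchanged, because the coefficient of the last column is 1, and makes all entries of the new
  column except the lowest one vanish; expansion along it leaves the minor \<open>L n\<close>.
\<close>

lemma L_Suc:
  fixes x :: "nat \<Rightarrow> 'p::prime_card pol"
  assumes sol: "\<And>a. a \<in> {1..n} \<Longrightarrow> (\<Sum>t\<le>n. x t * Y a ^ (CARD('p) ^ t)) = 0"
    and "x n = 1"
  shows "L (Suc n) = (\<Sum>t\<le>n. x t * Y (Suc n) ^ (CARD('p) ^ t)) * L n"
proof -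
  define A :: "'p pol mat" where "A = mat (Suc n) (Suc n) (\<lambda>(a, b). Y (Suc a) ^ (CARD('p) ^ b))"
  define B where "B = replace_col A (A *\<^sub>v vec (Suc n) x) n"
  let ?f = "\<Sum>t\<le>n. x t * Y (Suc n) ^ (CARD('p) ^ t)"
  have A: "A \<in> carrier_mat (Suc n) (Suc n)" by (simp add: A_def)
  have B: "B \<in> carrier_mat (Suc n) (Suc n)" by (simp add: A_def B_def replace_col_def)
  have "(A *\<^sub>v vec (Suc n) x) $ a = (\<Sum>t\<le>n. x t * Y (Suc a) ^ (CARD('p) ^ t))" if "a \<le> n" for a
    using that
    by (auto simp: A_def scalar_prod_def lessThan_Suc_atMost[symmetric] lessThan_atLeast0
        mult.commute simp del: sum.op_ivl_Suc intro!: sum.cong)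
  then have col: "B $$ (a, n) = (if a = n then ?f else 0)" if "a \<le> n" for a
    using that sol[of "Suc a"] by (auto simp: A_def B_def replace_col_def)
  have minor: "det (mat_delete B n n) = L n"
    unfolding L_def bracket_def
    by (intro arg_cong[of _ _ det] eq_matI) (auto simp: A_def B_def replace_col_def mat_delete_def)
  have "L (Suc n) = det A"
    unfolding L_def bracket_def A_def by (intro arg_cong[of _ _ det] eq_matI) (auto simp del: upt_Suc)
  also have "\<dots> = det B"
    using cramer_lemma_mat[OF A, of "vec (Suc n) x" n] assms(2) by (simp add: B_def)
  also have "\<dots> = (\<Sum>a<Suc n. B $$ (a, n) * cofactor B a n)"
    by (rule laplace_expansion_column[OF B]) simp
  also have "\<dots> = (\<Sum>a<Suc n. if a = n then ?f * L n else 0)"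
    by (rule sum.cong) (auto simp: col cofactor_def minor)
  finally show ?thesis by simp
qed


section \<open>The additive polynomial\<close>

text \<open>
  The equation for \<open>Suc n\<close> compares coefficients in
  \<open>f\<^bsub>n+1\<^esub>(X) = f\<^sub>n(X)\<^sup>p - f\<^sub>n(y\<^bsub>n+1\<^esub>)\<^bsup>p-1\<^esup> f\<^sub>n(X)\<close>. This identity holds for the products of
  linear factors since \<open>f\<^bsub>n+1\<^esub>(X)\<close> is the product over the scalars \<open>c\<close> of
  \<open>f\<^sub>n(X - c y\<^bsub>n+1\<^esub>) = f\<^sub>n(X) - c f\<^sub>n(y\<^bsub>n+1\<^esub>)\<close>, and \<open>Z\<^sup>p - b\<^bsup>p-1\<^esup> Z\<close> is the product of the
  factors \<open>Z - c b\<close>.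
\<close>

primrec root_coeff :: "nat \<Rightarrow> nat \<Rightarrow> 'p::prime_card pol" where
  "root_coeff 0 = (\<lambda>s. if s = 0 then 1 else 0)"
| "root_coeff (Suc n) = (\<lambda>s. (if s = 0 then 0 else root_coeff n (s - 1) ^ CARD('p)) -
     (\<Sum>t\<le>n. root_coeff n t * Y (Suc n) ^ (CARD('p) ^ t)) ^ (CARD('p) - 1) * root_coeff n s)"

definition root_poly :: "nat \<Rightarrow> 'p::prime_card pol \<Rightarrow> 'p pol" where
  "root_poly n x = (\<Sum>t\<le>n. root_coeff n t * x ^ (CARD('p) ^ t))"

lemma CARD_pos: "0 < CARD('p::prime_card)"
  using prime_card[where 'a='p] prime_gt_0_nat by blast

lemma root_coeff_Suc: "root_coeff (Suc n) s =
    (if s = 0 then 0 else root_coeff n (s - 1) ^ CARD('p)) -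
    root_poly n (Y (Suc n)) ^ (CARD('p) - 1) * (root_coeff n s :: 'p::prime_card pol)"
  by (simp add: root_poly_def)

declare root_coeff.simps(2) [simp del]

lemma root_coeff_eq_0: "n < s \<Longrightarrow> root_coeff n s = (0 :: 'p::prime_card pol)"
  by (induction n arbitrary: s) (auto simp: root_coeff_Suc CARD_pos power_0_left)

lemma root_coeff_monic: "root_coeff n n = (1 :: 'p::prime_card pol)"
  by (induction n) (auto simp: root_coeff_Suc root_coeff_eq_0)

lemma pols_root_coeff: "root_coeff n s \<in> (pols n :: 'p::prime_card pol set)"
proof (induction n arbitrary: s)
  case (Suc n)
  have "root_coeff n t \<in> (pols (Suc n) :: 'p pol set)" for t
    by (rule subsetD[OF pols_mono Suc]) simp
  then show ?case
    by (auto simp: root_coeff_Suc root_poly_def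
        intro!: pols_diff pols_uminus pols_mult pols_power pols_sum pols_zero pols_Y)
qed (auto simp: pols_zero pols_one)

text \<open>
  The Frobenius map is additive, so \<open>f\<^sub>n(x)\<^sup>p\<close> has the coefficients \<open>c\<^sub>s\<^sup>p\<close>, shifted by one place.
\<close>

lemma root_poly_Suc:
  "root_poly (Suc n) x = root_poly n x ^ CARD('p) -
     root_poly n (Y (Suc n)) ^ (CARD('p) - 1) * (root_poly n x :: 'p::prime_card pol)"
proof -
  let ?g = "root_poly n (Y (Suc n)) ^ (CARD('p) - 1) :: 'p pol"
  have "prime CHAR('p pol)" by (simp add: CHAR_pol prime_card)
  note frob = freshmans_dream_sum[OF this refl, unfolded CHAR_pol]
  have "root_poly (Suc n) x =
      (\<Sum>s\<le>Suc n. (if s = 0 then 0 else root_coeff n (s - 1) ^ CARD('p)) * x ^ (CARD('p) ^ s)) -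
      (\<Sum>s\<le>Suc n. ?g * root_coeff n s * x ^ (CARD('p) ^ s))"
    unfolding root_poly_def[of "Suc n"] root_coeff_Suc by (simp only: left_diff_distrib sum_subtractf)
  also have "(\<Sum>s\<le>Suc n. (if s = 0 then 0 else root_coeff n (s - 1) ^ CARD('p)) * x ^ (CARD('p) ^ s)) =
      (\<Sum>s\<le>n. root_coeff n s ^ CARD('p) * x ^ (CARD('p) ^ Suc s))"
    by (subst sum.atMost_Suc_shift) simp
  also have "\<dots> = root_poly n x ^ CARD('p)"
    by (simp add: root_poly_def frob power_mult_distrib power_mult [symmetric] mult.commute)
  also have "(\<Sum>s\<le>Suc n. ?g * root_coeff n s * x ^ (CARD('p) ^ s)) = ?g * root_poly n x"
    by (simp add: root_coeff_eq_0 root_poly_def sum_distrib_left mult.assoc)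
  finally show ?thesis .
qed

text \<open>
  Roots of \<open>f\<^sub>n\<close> stay roots of \<open>f\<^bsub>n+1\<^esub>\<close> by the recursion, and the new variable becomes one because
  \<open>b\<^sup>p - b\<^bsup>p-1\<^esup> b = 0\<close> for \<open>b = f\<^sub>n(y\<^bsub>n+1\<^esub>)\<close>.
\<close>

lemma root_poly_Y: "a \<in> {1..n} \<Longrightarrow> root_poly n (Y a) = (0 :: 'p::prime_card pol)"
proof (induction n)
  case (Suc n)
  have "z ^ CARD('p) = z ^ (CARD('p) - 1) * z" for z :: "'p pol"
    using CARD_pos[where 'p='p] by (simp add: power_eq_if mult.commute)
  with Suc show ?case
    by (cases "a = Suc n") (auto simp: root_poly_Suc CARD_pos power_0_left)
qed simp

text \<open>
  The coefficients of \<open>f\<^sub>n\<close> do not involve \<open>y\<^bsub>n+1\<^esub>\<close>. Hence the pure power of \<open>y\<^bsub>n+1\<^esub>\<close> with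
  exponent \<open>p\<^sup>n\<close> occurs only in the leading term of \<open>f\<^sub>n(y\<^bsub>n+1\<^esub>)\<close>, with coefficient 1.
\<close>

lemma root_poly_Y_Suc_nonzero: "root_poly n (Y (Suc n)) \<noteq> (0 :: 'p::prime_card pol)"
proof
  assume 0: "root_poly n (Y (Suc n)) = (0 :: 'p pol)"
  define m where "m = Poly_Mapping.single (Suc n) (CARD('p) ^ n)"
  have "Poly_Mapping.lookup (root_coeff n t * Y (Suc n) ^ (CARD('p) ^ t) :: 'p pol) m = 0"
    if "t < n" for t
  proof (rule ccontr)
    let ?h = "root_coeff n t * Y (Suc n) ^ (CARD('p) ^ t) :: 'p pol"
    assume "Poly_Mapping.lookup ?h m \<noteq> 0"
    then have "m \<in> Poly_Mapping.keys ?h" by (simp add: in_keys_iff)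
    then obtain k where k: "k \<in> Poly_Mapping.keys (root_coeff n t :: 'p pol)"
      and m: "m = k + Poly_Mapping.single (Suc n) (CARD('p) ^ t)"
      using keys_mult[of "root_coeff n t" "Y (Suc n) ^ (CARD('p) ^ t) :: 'p pol"]
      by (auto simp: Y_power)
    have "Suc n \<notin> Poly_Mapping.keys k"
      using k pols_root_coeff[of n t] unfolding pols_def by fastforce
    then have "CARD('p) ^ n = CARD('p) ^ t"
      using arg_cong[OF m, of "\<lambda>q. Poly_Mapping.lookup q (Suc n)"]
      by (simp add: m_def lookup_add in_keys_iff)
    then show False
      using that prime_gt_1_nat[OF prime_card[where 'a='p]] by simp
  qed
  then have "Poly_Mapping.lookup (root_poly n (Y (Suc n)) :: 'p pol) m =
      Poly_Mapping.lookup (Y (Suc n) ^ (CARD('p) ^ n) :: 'p pol) m"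
    by (simp add: root_poly_def lessThan_Suc_atMost [symmetric] lookup_add lookup_sum root_coeff_monic)
  then show False by (simp add: 0 Y_power m_def)
qed

lemma L_Suc_root_poly: "L (Suc n) = root_poly n (Y (Suc n)) * (L n :: 'p::prime_card pol)"
  unfolding root_poly_def
  by (rule L_Suc) (auto simp: root_coeff_monic root_poly_Y[unfolded root_poly_def])

lemma L_nonzero: "L n \<noteq> (0 :: 'p::prime_card pol)"
proof (induction n)
  case 0
  then show ?case by (simp add: L_def bracket_def)
next
  case (Suc n)
  then show ?case by (simp add: L_Suc_root_poly root_poly_Y_Suc_nonzero)
qed

text \<open>
  Both sides acquire the factor \<open>- f\<^sub>n(y\<^bsub>n+1\<^esub>)\<^bsup>p-1\<^esup>\<close> when \<open>n\<close> grows by one.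
\<close>

lemma root_coeff_0: "root_coeff n 0 = (-1) ^ n * (L n :: 'p::prime_card pol) ^ (CARD('p) - 1)"
proof (induction n)
  case 0
  then show ?case by (simp add: L_def bracket_def)
next
  case (Suc n)
  then show ?case by (simp add: root_coeff_Suc L_Suc_root_poly power_mult_distrib)
qed

lemma sum_root_coeff_lessThan:
  assumes "a \<in> {1..n}"
  shows "(\<Sum>t<n. root_coeff n t * Y a ^ (CARD('p) ^ t)) = - 1 * (Y a :: 'p::prime_card pol) ^ (CARD('p) ^ n)"
  using root_poly_Y[OF assms, where 'p='p]
  by (simp add: root_poly_def lessThan_Suc_atMost [symmetric] root_coeff_monic eq_neg_iff_add_eq_0)

text \<open>
  Cramer's rule with \<open>u = -1\<close> and \<open>e = n\<close> shows that the quotient defining the Dickson invariant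
  exists; it is unique because \<open>L n\<close> is not a zero divisor.
\<close>

lemma dickson_eq_root_coeff:
  assumes "s < n"
  shows "dickson n s = (-1) ^ (n - s) * (root_coeff n s :: 'p::prime_card pol)" (is "_ = ?q")
proof -
  have "[Suc s..<Suc n] = [Suc s..<n] @ [n]" using assms by simp
  then have "root_coeff n s * L n = (-1) ^ (n - 1 - s) * (- 1) * (L_omit n s :: 'p pol)"
    unfolding L_omit_def using cramer_bracket[OF sum_root_coeff_lessThan assms] by simp
  moreover have "n - s = Suc (n - 1 - s)" using assms by simp
  ultimately have q: "?q * L n = L_omit n s"
    by (cases "even (n - 1 - s)") (simp_all add: algebra_simps)
  have "?q \<in> pols n"
    by (intro pols_mult pols_power pols_uminus pols_one pols_root_coeff)
  then show ?thesis
    unfolding dickson_def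
  proof (intro the_equality conjI)
    fix r :: "'p pol"
    assume "r \<in> pols n \<and> r * L n = L_omit n s"
    then show "r = ?q" using q L_nonzero[of n] by (metis mult_right_cancel)
  qed (use q in auto)
qed


section \<open>Derivations of the Dickson invariants\<close>

text \<open>
  The values may lie outside \<open>pols n\<close>, and the rules are required on \<open>pols n\<close> only: this is what
  each component of the Steenrod operation satisfies.
\<close>

locale pols_derivation =
  fixes n :: nat and \<delta> :: "'p::prime_card pol \<Rightarrow> 'p pol"
  assumes add: "f \<in> pols n \<Longrightarrow> g \<in> pols n \<Longrightarrow> \<delta> (f + g) = \<delta> f + \<delta> g"
    and mult: "f \<in> pols n \<Longrightarrow> g \<in> pols n \<Longrightarrow> \<delta> (f * g) = \<delta> f * g + f * \<delta> g"
begin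

lemma zero: "\<delta> 0 = 0"
  using add[OF pols_zero pols_zero] by (metis add_0 add_cancel_right_right)

lemma one: "\<delta> 1 = 0"
  using mult[OF pols_one pols_one] by (metis mult_1 mult_1_right add_cancel_right_right)

lemma uminus: "f \<in> pols n \<Longrightarrow> \<delta> (- f) = - \<delta> f"
  using add[of f "- f"] by (simp add: zero pols_uminus eq_neg_iff_add_eq_0 add.commute)

lemma sum: "(\<And>a. a \<in> A \<Longrightarrow> f a \<in> pols n) \<Longrightarrow> \<delta> (sum f A) = (\<Sum>a\<in>A. \<delta> (f a))"
  by (induction A rule: infinite_finite_induct) (simp_all add: zero add pols_sum)

lemma power: "f \<in> pols n \<Longrightarrow> \<delta> (f ^ k) = of_nat k * f ^ (k - 1) * \<delta> f"
proof (induction k)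
  case (Suc k)
  then show ?case by (cases k) (simp_all add: mult pols_mult pols_power algebra_simps)
qed (simp add: one)

lemma sign: "f \<in> pols n \<Longrightarrow> \<delta> ((-1) ^ k * f) = (-1) ^ k * \<delta> f"
  by (cases "even k") (simp_all add: uminus)

lemma CARD_power: "f \<in> pols n \<Longrightarrow> 0 < t \<Longrightarrow> \<delta> (f ^ (CARD('p) ^ t)) = 0"
  using of_nat_CHAR[where 'a="'p pol"] by (simp add: power CHAR_pol)

text \<open>
  The factor \<open>w\<close> allows for components of the operation that vanish on all variables.
\<close>

lemma dickson:
  assumes Y: "\<And>a. a \<in> {1..n} \<Longrightarrow> \<delta> (Y a) = w * Y a ^ (CARD('p) ^ i)"
    and s: "s < n"
  shows "\<delta> (dickson n s) =
    w * ((-1) ^ n * bracket ([0..<s] @ [Suc s..<n] @ [i]) * L n ^ (CARD('p) - 2))"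
proof -
  let ?c = "root_coeff n :: nat \<Rightarrow> 'p pol"
  let ?b = "bracket ([0..<s] @ [Suc s..<n] @ [i]) :: 'p pol"
  have n: "0 < n" using s by simp
  have sys: "(\<Sum>t<n. \<delta> (?c t) * Y a ^ (CARD('p) ^ t)) = - (w * ?c 0) * Y a ^ (CARD('p) ^ i)"
    if a: "a \<in> {1..n}" for a
  proof -
    have P: "?c t \<in> pols n" "Y a ^ (CARD('p) ^ t) \<in> (pols n :: 'p pol set)" for t
      using pols_Y[OF a] by (auto intro: pols_root_coeff pols_power)
    \<comment> \<open>Differentiate the equation \<open>f\<^sub>n(y\<^sub>a) = 0\<close>, with its leading term on the other side; \<open>n > 0\<close>
      makes that term a \<open>p\<close>-th power up to sign.\<close>
    have "0 = \<delta> (- 1 * Y a ^ (CARD('p) ^ n))"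
      using CARD_power[OF pols_Y[OF a] n] uminus[OF P(2)[of n]] by simp
    also have "\<dots> = (\<Sum>t<n. \<delta> (?c t * Y a ^ (CARD('p) ^ t)))"
      by (subst sum_root_coeff_lessThan[OF a, symmetric]) (intro sum pols_mult P)
    also have "\<dots> = (\<Sum>t<n. \<delta> (?c t) * Y a ^ (CARD('p) ^ t) +
        (if t = 0 then ?c 0 * (w * Y a ^ (CARD('p) ^ i)) else 0))"
    proof (rule sum.cong)
      fix t
      show "\<delta> (?c t * Y a ^ (CARD('p) ^ t)) = \<delta> (?c t) * Y a ^ (CARD('p) ^ t) +
          (if t = 0 then ?c 0 * (w * Y a ^ (CARD('p) ^ i)) else 0)"
        using P(2)[of t] CARD_power[OF pols_Y[OF a], of t] Y[OF a]
        by (cases "t = 0") (simp_all add: mult P)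
    qed simp
    finally show ?thesis
      using n by (simp add: sum.distrib eq_neg_iff_add_eq_0 mult_ac)
  qed
  have "\<delta> (dickson n s) * L n = (-1) ^ (n - s) * (\<delta> (?c s) * L n)"
    by (simp add: dickson_eq_root_coeff s sign pols_root_coeff)
  also have "\<dots> = (-1) ^ (n - s) * ((-1) ^ (n - 1 - s) * - (w * ?c 0) * ?b)"
    using cramer_bracket[OF sys s] by simp
  also have "n - s = Suc (n - 1 - s)" using s by simp
  also have "(-1) ^ Suc (n - 1 - s) * ((-1) ^ (n - 1 - s) * - (w * ?c 0) * ?b) = w * ?c 0 * ?b"
    by (cases "even (n - 1 - s)") simp_all
  also have "?c 0 = (-1) ^ n * (L n ^ (CARD('p) - 2) * L n)"
  proof -
    have "CARD('p) - 1 = Suc (CARD('p) - 2)"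
      using prime_gt_1_nat[OF prime_card[where 'a='p]] by simp
    then show ?thesis by (simp add: root_coeff_0 mult.commute)
  qed
  finally have "\<delta> (dickson n s) * L n =
      w * ((-1) ^ n * ?b * L n ^ (CARD('p) - 2)) * L n"
    by (simp add: mult_ac)
  then show ?thesis using L_nonzero[of n] by (metis mult_right_cancel)
qed

end


section \<open>The operation on the exterior-polynomial algebra\<close>

lemma pols_dickson: "s < n \<Longrightarrow> dickson n s \<in> pols n"
  by (auto simp: dickson_eq_root_coeff
      intro!: pols_mult pols_power pols_uminus pols_one pols_root_coeff)

lemma eadd_of_pol: "eadd (of_pol f) (of_pol g) = of_pol (f + g)"
  by (auto simp: eadd_def of_pol_def)

lemma emult_of_pol_right: "finite U \<Longrightarrow> emult F (of_pol g) U = F U * g"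
proof -
  assume U: "finite U"
  have "emult F (of_pol g) U = (\<Sum>S\<in>Pow U. if S = U then F U * g else 0)"
    unfolding emult_def by (rule sum.cong) (auto simp: of_pol_def shuffle_sign_empty Diff_cancel)
  then show ?thesis using U by simp
qed

lemma emult_of_pol_left: "finite U \<Longrightarrow> emult (of_pol f) G U = f * G U"
proof -
  assume U: "finite U"
  have "emult (of_pol f) G U = (\<Sum>S\<in>Pow U. if S = {} then f * G U else 0)"
    unfolding emult_def by (rule sum.cong) (auto simp: of_pol_def shuffle_sign_empty)
  then show ?thesis using U by simp
qed

text \<open>
  The operation acts on polynomials through one derivation for each exterior monomial \<open>x\<^sub>U\<close>. For
  finite \<open>U\<close>, multiplication by a polynomial acts on the component at \<open>U\<close> from either side, which
  turns the Leibniz rule of the algebra into that of the component.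
\<close>

lemma pols_derivation_component:
  assumes D: "is_St_Delta i n D" and U: "finite U"
  shows "pols_derivation n (\<lambda>f. D (of_pol f) U)"
proof
  fix f g :: "'a pol" assume fg: "f \<in> pols n" "g \<in> pols n"
  have "D (eadd (of_pol f) (of_pol g)) = eadd (D (of_pol f)) (D (of_pol g))"
    using D fg P_of_pol unfolding is_St_Delta_def by blast
  then show "D (of_pol (f + g)) U = D (of_pol f) U + D (of_pol g) U"
    by (simp add: eadd_of_pol) (simp add: eadd_def)
  have "D (emult (of_pol f) (of_pol g)) =
      eadd (emult (D (of_pol f)) (of_pol g)) (emult (of_pol f) (D (of_pol g)))"
    using D fg P_of_pol unfolding is_St_Delta_def by blast
  then show "D (of_pol (f * g)) U = D (of_pol f) U * g + f * D (of_pol g) U"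
    using U by (simp add: emult_of_pol)
      (simp add: eadd_def emult_of_pol_left emult_of_pol_right)
qed

theorem theorem3p1:
  fixes i n s :: nat
  assumes "odd CARD('p::prime_card)"
    and "s < n" and "1 \<le> i"
  shows "St_Delta i n (of_pol (dickson n s :: 'p pol)) =
    of_pol ((-1) ^ n * bracket ([0..<s] @ [Suc s..<n] @ [i]) * L n ^ (CARD('p) - 2))"
    (is "_ = of_pol ?r")
proof -
  define D :: "'p epol \<Rightarrow> 'p epol" where "D = St_Delta i n"
  have D: "is_St_Delta i n D"
    unfolding D_def St_Delta_def by (rule theI'[OF ex1_St_Delta[OF \<open>1 \<le> i\<close>]])
  have "D (of_pol (dickson n s)) U = of_pol ?r U" for U
  proof (cases "finite U")
    case True
    interpret pols_derivation n "\<lambda>f. D (of_pol f) U"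
      by (rule pols_derivation_component[OF D True])
    \<comment> \<open>The component at \<open>U = {}\<close> is the derivation \<open>y\<^sub>a \<mapsto> y\<^sub>a\<^bsup>p^i\<^esup>\<close>; at any other \<open>U\<close> all
      variables go to 0.\<close>
    let ?w = "of_pol 1 U :: 'p pol"
    have "D (of_pol (Y a)) U = ?w * Y a ^ (CARD('p) ^ i)" if "a \<in> {1..n}" for a
      using D that by (simp add: is_St_Delta_def of_pol_def)
    from dickson[OF this \<open>s < n\<close>] show ?thesis by (simp add: of_pol_def)
  next
    case False
    \<comment> \<open>Elements of the algebra vanish at sets that are not contained in \<open>{1..n}\<close>.\<close>
    then have "\<not> U \<subseteq> {1..n}" using finite_subset by blast
    moreover have "D (of_pol (dickson n s)) \<in> P n"
      using D P_of_pol[OF pols_dickson[OF \<open>s < n\<close>]] unfolding is_St_Delta_def by blast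
    ultimately show ?thesis using False by (auto simp: P_def of_pol_def)
  qed
  then show ?thesis unfolding D_def by blast
qed

end
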